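(* Let $A\in\mathbb{R}^{n\times n}$ be symmetric positive definite with eigenvalues $0<\lambda_1\le\lambda_2\le\dots\le\lambda_n$ and condition number $\kappa=\lambda_n/\lambda_1$, let $b\in\mathbb{R}^n$, $c\in\mathbb{R}$, $f(x)=\frac12 x^TAx-b^Tx+c$, and let $\theta\in(0,1]$. Let $x_0\in\mathbb{R}^n$ be any initial point for RelaxME with relaxation parameter $\theta$. Then RelaxME generates a sequence $(x_k)_{k\ge0}\subset\mathbb{R}^n$ that converges to $x_*$, the unique minimizer of $f$. Moreover, the convergence is linear: setting $$\bar\eta:=(1-\theta)+\theta\left(\frac{\kappa-1}{\kappa+1}\right)^4\in[0,1),$$ there is a real number $\eta$ with $0\le\eta\le\bar\eta$ such that for all $k\ge0$, $$f(x_k)-f(x_* )\le\eta^k\,(f(x_0)-f(x_* ))\qquad\text{and}\qquad \|x_k-x_*\|_A\le\sqrt{\eta^k}\,\|x_0-x_*\|_A.$$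
   Context: Notation: $\|x\|_A=\sqrt{x^TAx}$, $\|\cdot\|$ is the Euclidean norm, $\nabla f(x)=Ax-b$, and $0^0=1$. RelaxME (relaxed method of ellipcenters) with parameter $\theta\in(0,1]$ and initial point $x_0$: set $g_0=\nabla f(x_0)$. For $k=0,1,2,\dots$, as long as $g_k\ne0$, perform iteration $k$: - $w_k=Ag_k$, $t_k=\dfrac{2\|g_k\|^2}{g_k^Tw_k}$, $y_k=x_k-t_kg_k$, $r_k=g_k-t_kw_k$. - If $g_k$ and $r_k$ are linearly independent, let $(\alpha_k,\beta_k)$ be the minimizer over $(\alpha,\beta)\in\mathbb{R}^2$ of $f(x_k+\alpha g_k+\beta r_k)$ and set $\tilde x_{k+1}=x_k+\alpha_kg_k+\beta_kr_k$. Then: if $k=0$, set $x_1=\tilde x_1$ and $g_1=\nabla f(\tilde x_1)$; if $k\ge1$, set $x_{k+1}=(1-\theta)x_k+\theta\tilde x_{k+1}$ and $g_{k+1}=(1-\theta)g_k+\theta\nabla f(\tilde x_{k+1})$. - If $g_k$ and $r_k$ are linearly dependent, set $\tilde x_{k+1}=\frac12(x_k+y_k)$, $x_{k+1}=\tilde x_{k+1}$, $g_{k+1}=\nabla f(\tilde x_{k+1})$, and stop. If the method stops with last computed iterate $x_K$ (either because $g_K=0$ or after the linearly dependent case), set $x_k=x_K$ for all $k\ge K$. *)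

theory Defs
  imports "HOL-Analysis.Analysis"
begin

definition pos_definite :: "real^'n^'n \<Rightarrow> bool" where
  "pos_definite A \<longleftrightarrow> transpose A = A \<and> (\<forall>x. x \<noteq> 0 \<longrightarrow> 0 < x \<bullet> (A *v x))"

text \<open>The numbers \<open>lam 1 \<le> \<dots> \<le> lam n\<close>, where \<open>n = CARD('n)\<close>, are the roots of the
  characteristic polynomial of \<open>A\<close>, repeated according to multiplicity. Values of \<open>lam\<close>
  outside \<open>{1..n}\<close> are irrelevant.\<close>

definition eigenvalue_listing :: "real^'n^'n \<Rightarrow> (nat \<Rightarrow> real) \<Rightarrow> bool" where
  "eigenvalue_listing A lam \<longleftrightarrow>
     mono_on {1..CARD('n)} lam \<and>
     (\<forall>t. det (mat t - A) = (\<Prod>i = 1..CARD('n). t - lam i))"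

definition quad_fun :: "real^'n^'n \<Rightarrow> real^'n \<Rightarrow> real \<Rightarrow> real^'n \<Rightarrow> real" where
  "quad_fun A b c x = (1/2) * (x \<bullet> (A *v x)) - b \<bullet> x + c"

definition quad_grad :: "real^'n^'n \<Rightarrow> real^'n \<Rightarrow> real^'n \<Rightarrow> real^'n" where
  "quad_grad A b x = A *v x - b"

definition mat_norm :: "real^'n^'n \<Rightarrow> real^'n \<Rightarrow> real" where
  "mat_norm A x = sqrt (x \<bullet> (A *v x))"

text \<open>One step of the method at iteration \<open>k\<close>, from \<open>(x, g, halted)\<close> to \<open>(x', g', halted')\<close>.
  The flag records that the method has stopped; from then on the iterate is repeated forever.
  It is set when \<open>g = 0\<close> or after the linearly dependent case. The inequality \<open>g \<noteq> r\<close> is needed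
  to express linear independence of the pair \<open>(g, r)\<close> through that of the set \<open>{g, r}\<close>.\<close>

definition relaxME_step ::
  "real^'n^'n \<Rightarrow> real^'n \<Rightarrow> real \<Rightarrow> real \<Rightarrow> nat \<Rightarrow>
   real^'n \<Rightarrow> real^'n \<Rightarrow> bool \<Rightarrow> real^'n \<Rightarrow> real^'n \<Rightarrow> bool \<Rightarrow> bool" where
  "relaxME_step A b c \<theta> k x g halted x' g' halted' \<longleftrightarrow>
     (if halted \<or> g = 0 then x' = x \<and> g' = g \<and> halted'
      else
        (let w = A *v g;
             t = 2 * (norm g)\<^sup>2 / (g \<bullet> w);
             y = x - t *\<^sub>R g;
             r = g - t *\<^sub>R w
         in
           if g \<noteq> r \<and> independent {g, r} then
             \<not> halted' \<and>
             (\<exists>\<alpha> \<beta>.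
                is_arg_min (\<lambda>(\<alpha>, \<beta>). quad_fun A b c (x + \<alpha> *\<^sub>R g + \<beta> *\<^sub>R r)) (\<lambda>_. True) (\<alpha>, \<beta>) \<and>
                (let xt = x + \<alpha> *\<^sub>R g + \<beta> *\<^sub>R r
                 in
                   if k = 0 then x' = xt \<and> g' = quad_grad A b xt
                   else x' = (1 - \<theta>) *\<^sub>R x + \<theta> *\<^sub>R xt \<and>
                        g' = (1 - \<theta>) *\<^sub>R g + \<theta> *\<^sub>R quad_grad A b xt))
           else
             halted' \<and> x' = (1/2) *\<^sub>R (x + y) \<and> g' = quad_grad A b x'))"

definition relaxME_sequence ::
  "real^'n^'n \<Rightarrow> real^'n \<Rightarrow> real \<Rightarrow> real \<Rightarrow> real^'n \<Rightarrow> (nat \<Rightarrow> real^'n) \<Rightarrow> bool" where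
  "relaxME_sequence A b c \<theta> x0 x \<longleftrightarrow>
     (\<exists>g halted.
        x 0 = x0 \<and> g 0 = quad_grad A b x0 \<and> \<not> halted 0 \<and>
        (\<forall>k. relaxME_step A b c \<theta> k (x k) (g k) (halted k)
               (x (Suc k)) (g (Suc k)) (halted (Suc k))))"

end

theory Submission
  imports Defs
begin

text \<open>
  While the vector \<open>g\<close> kept by the method is the true gradient at the current iterate \<open>x\<close>, a step,
  before relaxation, minimizes \<open>f\<close> over the plane \<open>x + span {g, A g}\<close>. With \<open>e = x - xstar\<close> the error, \<open>g = A e\<close>,
  so this plane contains \<open>xstar + (I - s A)\<^sup>2 e\<close>, the result of two gradient steps of any fixed
  length \<open>s\<close>. For \<open>s = 2 / (L + l)\<close>, where \<open>l\<close> and \<open>L\<close> are the extreme eigenvalues, each of the two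
  steps multiplies the energy norm of the error by at most \<open>(L - l) / (L + l)\<close>
  (\<open>richardson_step_contraction\<close>), and \<open>f x - f xstar\<close> is half the square of that norm. Hence
  minimization over the plane contracts the gap in \<open>f\<close> by \<open>((L - l) / (L + l)) ^ 4\<close>
  (\<open>plane_minimizer_decrease\<close>), and convexity of \<open>f\<close> turns relaxation with \<open>\<theta>\<close> into the convex
  combination \<open>\<eta>bar\<close> of this factor and \<open>1\<close>.

  The relaxed update preserves \<open>g = \<nabla>f x\<close> because the gradient is affine and the weights add up
  to \<open>1\<close>. If the two directions are dependent, \<open>g\<close> is an eigenvector of \<open>A\<close> and the midpoint step is
  an exact line search that reaches \<open>xstar\<close>; so a method that has stopped is at \<open>xstar\<close>
  (\<open>relaxME_step_decrease\<close>).

  The contraction estimate rests on the bounds \<open>l * (x \<bullet> x) \<le> x \<bullet> A x \<le> L * (x \<bullet> x)\<close>. They follow from the characteristic polynomial because a minimizer of \<open>x \<bullet> A x\<close> on the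
  unit sphere is an eigenvector (\<open>lower_rayleigh_eigenvector\<close>).
\<close>

section \<open>Quadratic forms and extreme eigenvalues\<close>

lemma inner_matrix_commute:
  fixes B :: "real^'n^'n"
  assumes "transpose B = B"
  shows "x \<bullet> (B *v y) = y \<bullet> (B *v x)"
  by (metis assms dot_lmul_matrix inner_commute transpose_matrix_vector)

text \<open>At a null vector a semidefinite form attains its minimum, so the derivative \<open>2 (u \<bullet> B v)\<close> in
  every direction \<open>u\<close> vanishes there, in particular for \<open>u = B v\<close>.\<close>
lemma semidefinite_null_vector:
  fixes B :: "real^'n^'n"
  assumes sym: "transpose B = B" and psd: "\<And>x. 0 \<le> x \<bullet> (B *v x)" and null: "v \<bullet> (B *v v) = 0"
  shows "B *v v = 0"
proof -
  define u N c where "u = B *v v" and "N = u \<bullet> u" and "c = u \<bullet> (B *v u)"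
  \<comment> \<open>The optimal \<open>t\<close> would be \<open>- N / c\<close>; the summand \<open>1\<close> covers the case \<open>c = 0\<close>.\<close>
  define t where "t = - N / (c + 1)"
  have c: "c \<ge> 0" unfolding c_def by (rule psd)
  have "u \<bullet> (B *v v) = N" "v \<bullet> (B *v u) = N"
    using inner_matrix_commute[OF sym, of v u] by (simp_all add: N_def u_def)
  then have "(v + t *\<^sub>R u) \<bullet> (B *v (v + t *\<^sub>R u)) = 2 * t * N + t\<^sup>2 * c"
    using null by (simp add: algebra_simps inner_add inner_simps matrix_vector_mult_scaleR
      matrix_vector_right_distrib power2_eq_square c_def)
  also have "\<dots> = - (N\<^sup>2 * ((c + 2) / (c + 1)\<^sup>2))"
    using c unfolding t_def by (simp add: divide_simps) (simp add: algebra_simps power2_eq_square)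
  finally have "N\<^sup>2 * ((c + 2) / (c + 1)\<^sup>2) \<le> 0"
    using psd[of "v + t *\<^sub>R u"] by linarith
  moreover have "(c + 2) / (c + 1)\<^sup>2 > 0" using c by simp
  ultimately have "N\<^sup>2 \<le> 0" by (meson mult_le_0_iff not_less)
  then have "N = 0" by simp
  then show ?thesis by (simp add: N_def u_def)
qed

lemma shifted_matrix_sym:
  fixes A :: "real^'n^'n"
  assumes "transpose A = A"
  shows "transpose (A - mat t) = A - mat t"
proof -
  have "A $ j $ i = A $ i $ j" for i j
    using assms by (metis transpose_def vec_lambda_beta)
  then show ?thesis by (simp add: transpose_def vec_eq_iff mat_def)
qed

lemma shifted_matrix_vector:
  fixes A :: "real^'n^'n"
  shows "(A - mat t) *v x = A *v x - t *\<^sub>R x"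
proof -
  have "mat t *v x = t *\<^sub>R x"
    by (simp add: vec_eq_iff matrix_vector_mult_def mat_def if_distrib[of "\<lambda>a. a * _"] cong: if_cong)
  then show ?thesis by (simp add: matrix_vector_mult_diff_rdistrib)
qed

text \<open>Compactness gives a minimizer \<open>v\<close> of the Rayleigh quotient, with value \<open>m\<close>. Then \<open>B - m\<close> is
  positive semidefinite with null vector \<open>v\<close>, which forces \<open>B v = m v\<close>. Applied to \<open>- A\<close>, the same
  statement gives the largest eigenvalue of \<open>A\<close>.\<close>
lemma lower_rayleigh_eigenvector:
  fixes B :: "real^'n^'n"
  assumes sym: "transpose B = B"
  obtains m v where "v \<noteq> 0" "B *v v = m *\<^sub>R v" "\<And>x. m * (x \<bullet> x) \<le> x \<bullet> (B *v x)"
proof -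
  have "sphere (0::real^'n) 1 \<noteq> {}" by simp
  moreover have "continuous_on (sphere 0 1) (\<lambda>x. x \<bullet> (B *v x))"
    by (intro continuous_intros)
  ultimately obtain v where v: "v \<in> sphere 0 1"
    and min: "\<And>x. x \<in> sphere 0 1 \<Longrightarrow> v \<bullet> (B *v v) \<le> x \<bullet> (B *v x)"
    using continuous_attains_inf[OF compact_sphere, of 0 1 "\<lambda>x. x \<bullet> (B *v x)"] by blast
  define m where "m = v \<bullet> (B *v v)"
  have vv: "v \<bullet> v = 1" using v by (simp add: dot_square_norm)
  have bound: "m * (x \<bullet> x) \<le> x \<bullet> (B *v x)" for x
  proof (cases "x = 0")
    case False
    have "m \<le> ((1 / norm x) *\<^sub>R x) \<bullet> (B *v ((1 / norm x) *\<^sub>R x))"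
      unfolding m_def using False by (intro min) simp
    also have "\<dots> = (x \<bullet> (B *v x)) / (x \<bullet> x)"
      by (simp add: matrix_vector_mult_scaleR dot_square_norm power2_eq_square)
    finally show ?thesis using False by (simp add: pos_le_divide_eq)
  qed simp
  have "(B - mat m) *v v = 0"
  proof (rule semidefinite_null_vector)
    show "transpose (B - mat m) = B - mat m" using sym by (rule shifted_matrix_sym)
    show "0 \<le> x \<bullet> ((B - mat m) *v x)" for x
      using bound[of x] by (simp add: shifted_matrix_vector inner_diff_right)
    show "v \<bullet> ((B - mat m) *v v) = 0"
      using vv by (simp add: shifted_matrix_vector inner_diff_right m_def)
  qed
  moreover have "v \<noteq> 0" using vv by auto
  ultimately show thesis using that bound by (simp add: shifted_matrix_vector)
qed

lemma eigenvalue_listing_iff: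
  fixes A :: "real^'n^'n"
  assumes "eigenvalue_listing A lam"
  shows "(\<exists>v. v \<noteq> 0 \<and> A *v v = t *\<^sub>R v) \<longleftrightarrow> (\<exists>i\<in>{1..CARD('n)}. t = lam i)"
proof -
  have "(mat t - A) *v v = t *\<^sub>R v - A *v v" for v
    using shifted_matrix_vector[of A t v] by (simp add: matrix_vector_mult_diff_rdistrib)
  then have "(\<exists>v. v \<noteq> 0 \<and> A *v v = t *\<^sub>R v) \<longleftrightarrow> (\<exists>v. v \<noteq> 0 \<and> (mat t - A) *v v = 0)"
    by auto
  also have "\<dots> \<longleftrightarrow> det (mat t - A) = 0"
    using invertible_det_nz[of "mat t - A"]
    unfolding invertible_left_inverse matrix_left_invertible_ker by blast
  also have "\<dots> \<longleftrightarrow> (\<exists>i\<in>{1..CARD('n)}. t = lam i)"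
    using assms by (simp add: eigenvalue_listing_def)
  finally show ?thesis .
qed

lemma extreme_eigenvalue_bounds:
  fixes A :: "real^'n^'n"
  assumes pd: "pos_definite A" and el: "eigenvalue_listing A lam"
  shows "0 < lam 1" "lam 1 \<le> lam (CARD('n))"
    "lam 1 * (x \<bullet> x) \<le> x \<bullet> (A *v x)" "x \<bullet> (A *v x) \<le> lam (CARD('n)) * (x \<bullet> x)"
proof -
  have sym: "transpose A = A" using pd by (simp add: pos_definite_def)
  have card: "1 \<le> CARD('n)" by (simp add: Suc_leI)
  have mono: "lam 1 \<le> lam i" "lam i \<le> lam (CARD('n))" if "i \<in> {1..CARD('n)}" for i
    using el that card by (auto simp: eigenvalue_listing_def intro: mono_onD)
  obtain v where "v \<noteq> 0" "A *v v = lam 1 *\<^sub>R v"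
    using eigenvalue_listing_iff[OF el, of "lam 1"] card by auto
  then have "0 < lam 1 * (v \<bullet> v)" "0 < v \<bullet> v"
    using pd by (auto simp: pos_definite_def)
  then show "0 < lam 1" by (simp add: zero_less_mult_iff)
  show "lam 1 \<le> lam (CARD('n))" using mono(1) card by simp
  obtain m u where u: "u \<noteq> 0" "A *v u = m *\<^sub>R u" and m: "\<And>x. m * (x \<bullet> x) \<le> x \<bullet> (A *v x)"
    using lower_rayleigh_eigenvector[OF sym] by blast
  have extreme: "lam 1 \<le> t \<and> t \<le> lam (CARD('n))" if "w \<noteq> 0" "A *v w = t *\<^sub>R w" for w t
  proof -
    have "\<exists>i\<in>{1..CARD('n)}. t = lam i"
      using that by (intro iffD1[OF eigenvalue_listing_iff[OF el]]) auto
    then show ?thesis using mono by auto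
  qed
  have "lam 1 \<le> m" using extreme[OF u] ..
  then show "lam 1 * (x \<bullet> x) \<le> x \<bullet> (A *v x)"
    using m[of x] by (meson inner_ge_zero mult_right_mono order_trans)
  have neg: "(- A) *v x = - (A *v x)" for x
    using matrix_vector_mult_diff_rdistrib[of 0 A x] by simp
  have "transpose (- A) = - transpose A" by (simp add: transpose_def vec_eq_iff)
  then have "transpose (- A) = - A" by (simp only: sym)
  then obtain m' u' where u': "u' \<noteq> 0" "(- A) *v u' = m' *\<^sub>R u'"
    and m': "\<And>x. m' * (x \<bullet> x) \<le> x \<bullet> ((- A) *v x)"
    using lower_rayleigh_eigenvector by blast
  have "A *v u' = (- m') *\<^sub>R u'" using arg_cong[OF u'(2), of uminus] by (simp add: neg)
  then have "- m' \<le> lam (CARD('n))" using extreme[OF u'(1)] by blast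
  then have "- m' * (x \<bullet> x) \<le> lam (CARD('n)) * (x \<bullet> x)"
    by (meson inner_ge_zero mult_right_mono)
  then show "x \<bullet> (A *v x) \<le> lam (CARD('n)) * (x \<bullet> x)"
    using m'[of x] by (simp add: neg)
qed

section \<open>Contraction of a gradient step in the energy norm\<close>

text \<open>On an eigenvector with eigenvalue \<open>\<mu>\<close> the claim is \<open>\<mu> (\<mu> - l) (L - \<mu>) \<ge> 0\<close>. Without
  diagonalization it follows for \<open>P = A - l\<close> and \<open>Q = L - A\<close>, which are semidefinite, commute and
  add up to \<open>L - l\<close>: from \<open>(L - l) P Q = P Q P + Q P Q\<close> the product \<open>P Q\<close> is semidefinite, and
  then so is \<open>A P Q = P Q P + l P Q\<close>.\<close>
lemma spectral_interval_product_nonneg: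
  fixes A :: "real^'n^'n"
  assumes sym: "transpose A = A" and l: "0 \<le> l" "l \<le> L"
    and lower: "\<And>x. l * (x \<bullet> x) \<le> x \<bullet> (A *v x)" and upper: "\<And>x. x \<bullet> (A *v x) \<le> L * (x \<bullet> x)"
  shows "0 \<le> (A *v (A *v e - l *\<^sub>R e)) \<bullet> (L *\<^sub>R e - A *v e)"
proof -
  define P Q where "P = (\<lambda>x. A *v x - l *\<^sub>R x)" and "Q = (\<lambda>x. L *\<^sub>R x - A *v x)"
  have P: "0 \<le> x \<bullet> P x" and Q: "0 \<le> x \<bullet> Q x" for x
    using lower[of x] upper[of x] by (simp_all add: P_def Q_def inner_diff_right)
  note expand = P_def Q_def inner_diff_left inner_diff_right
    matrix_vector_mult_diff_distrib matrix_vector_mult_scaleR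
  have com: "(A *v x) \<bullet> y = x \<bullet> (A *v y)" for x y
    using inner_matrix_commute[OF sym] by (metis inner_commute)
  have PQ: "0 \<le> P e \<bullet> Q e"
  proof (cases "l = L")
    case True
    \<comment> \<open>Here \<open>Q = - P\<close>, so both forms vanish and \<open>P\<close> itself is zero.\<close>
    have "e \<bullet> P e = 0" using P[of e] Q[of e] True by (simp add: expand)
    then have "(A - mat l) *v e = 0"
      using P by (intro semidefinite_null_vector)
        (simp_all add: shifted_matrix_sym[OF sym] shifted_matrix_vector P_def)
    then show ?thesis by (simp add: P_def shifted_matrix_vector)
  next
    case False
    have "(L - l) * (P e \<bullet> Q e) = P e \<bullet> Q (P e) + Q e \<bullet> P (Q e)"
      by (simp add: expand com algebra_simps)
    then have "0 \<le> (L - l) * (P e \<bullet> Q e)" using P Q by simp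
    then show ?thesis using False l(2) by (simp add: zero_le_mult_iff)
  qed
  have "(A *v P e) \<bullet> Q e = P e \<bullet> Q (P e) + l * (P e \<bullet> Q e)"
    by (simp add: expand com algebra_simps)
  then show ?thesis using PQ Q[of "P e"] l(1) by (simp add: P_def Q_def)
qed

text \<open>The step length \<open>2 / (L + l)\<close> minimizes the maximum of \<open>\<bar>1 - s \<mu>\<bar>\<close> over \<open>\<mu> \<in> {l..L}\<close>, the
  value being \<open>\<rho> = (L - l) / (L + l)\<close>. The excess of the right-hand side is governed by
  \<open>\<rho>\<^sup>2 - (1 - s \<mu>)\<^sup>2 = 4 (\<mu> - l) (L - \<mu>) / (L + l)\<^sup>2\<close>, with \<open>A\<close> in place of \<open>\<mu>\<close>.\<close>
lemma richardson_step_contraction: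
  fixes A :: "real^'n^'n"
  assumes sym: "transpose A = A" and l: "0 < l" "l \<le> L"
    and lower: "\<And>x. l * (x \<bullet> x) \<le> x \<bullet> (A *v x)" and upper: "\<And>x. x \<bullet> (A *v x) \<le> L * (x \<bullet> x)"
  defines "s \<equiv> 2 / (L + l)"
  shows "(e - s *\<^sub>R (A *v e)) \<bullet> (A *v (e - s *\<^sub>R (A *v e)))
    \<le> ((L - l) / (L + l))\<^sup>2 * (e \<bullet> (A *v e))"
proof -
  define a b c where "a = e \<bullet> (A *v e)" and "b = (A *v e) \<bullet> (A *v e)"
    and "c = (A *v e) \<bullet> (A *v (A *v e))"
  have com: "x \<bullet> (A *v y) = y \<bullet> (A *v x)" for x y by (rule inner_matrix_commute[OF sym])
  have lhs: "(e - s *\<^sub>R (A *v e)) \<bullet> (A *v (e - s *\<^sub>R (A *v e))) = a - 2 * s * b + s\<^sup>2 * c"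
    using com[of e "A *v e"]
    by (simp add: a_def b_def c_def inner_diff_left inner_diff_right matrix_vector_mult_diff_distrib
      matrix_vector_mult_scaleR power2_eq_square algebra_simps)
  have "(A *v (A *v e - l *\<^sub>R e)) \<bullet> (L *\<^sub>R e - A *v e) = (L + l) * b - c - l * L * a"
    using com[of e "A *v e"]
    by (simp add: a_def b_def c_def inner_diff_left inner_diff_right matrix_vector_mult_diff_distrib
      matrix_vector_mult_scaleR inner_commute algebra_simps)
  then have nonneg: "0 \<le> (L + l) * b - c - l * L * a"
    using spectral_interval_product_nonneg[OF sym _ l(2) lower upper, of e] l(1) by simp
  have "((L - l) / (L + l))\<^sup>2 * a - (a - 2 * s * b + s\<^sup>2 * c)
    = 4 / (L + l)\<^sup>2 * ((L + l) * b - c - l * L * a)"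
    using l unfolding s_def by (simp add: divide_simps) (simp add: algebra_simps power2_eq_square)
  also have "\<dots> \<ge> 0" using nonneg by simp
  finally show ?thesis unfolding lhs a_def by simp
qed

section \<open>The quadratic objective\<close>

lemma quad_fun_expand:
  assumes "transpose A = A"
  shows "quad_fun A b c (z + d) = quad_fun A b c z + d \<bullet> quad_grad A b z + (1/2) * (d \<bullet> (A *v d))"
  using inner_matrix_commute[OF assms, of z d]
  by (simp add: quad_fun_def quad_grad_def inner_add_left inner_add_right inner_diff_right
    matrix_vector_right_distrib inner_commute algebra_simps)

lemma quad_grad_add: "quad_grad A b (z + d) = quad_grad A b z + A *v d"
  by (simp add: quad_grad_def matrix_vector_right_distrib)

lemma quad_grad_affine:
  "quad_grad A b ((1 - \<theta>) *\<^sub>R x + \<theta> *\<^sub>R y) = (1 - \<theta>) *\<^sub>R quad_grad A b x + \<theta> *\<^sub>R quad_grad A b y"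
  by (simp add: quad_grad_def matrix_vector_right_distrib matrix_vector_mult_scaleR algebra_simps)

lemma pos_definite_nonneg:
  assumes "pos_definite A"
  shows "0 \<le> x \<bullet> (A *v x)"
  using assms by (cases "x = 0") (auto simp: pos_definite_def less_imp_le)

lemma quad_fun_gap:
  assumes "transpose A = A" "quad_grad A b xstar = 0"
  shows "quad_fun A b c x - quad_fun A b c xstar = (1/2) * ((x - xstar) \<bullet> (A *v (x - xstar)))"
  using quad_fun_expand[OF assms(1), of b c xstar "x - xstar"] assms(2) by simp

lemma quad_grad_zero_iff:
  assumes "pos_definite A" "quad_grad A b xstar = 0"
  shows "quad_grad A b x = 0 \<longleftrightarrow> x = xstar"
proof
  assume "quad_grad A b x = 0"
  then have "A *v (x - xstar) = 0"
    using assms(2) by (simp add: quad_grad_def matrix_vector_mult_diff_distrib)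
  then show "x = xstar" using assms(1)
    by (metis eq_iff_diff_eq_0 inner_zero_right less_irrefl pos_definite_def)
qed (use assms(2) in simp)

lemma quad_grad_zero_exists:
  fixes A :: "real^'n^'n"
  assumes "pos_definite A"
  obtains xstar where "quad_grad A b xstar = 0"
proof -
  have "x = 0" if "A *v x = 0" for x
    using assms that by (metis inner_zero_right less_irrefl pos_definite_def)
  then obtain B where "A ** B = mat 1"
    by (metis matrix_left_invertible_ker matrix_left_right_inverse)
  then have "quad_grad A b (B *v b) = 0"
    by (simp add: quad_grad_def matrix_vector_mul_assoc)
  then show thesis by (rule that)
qed

lemma quad_fun_convex:
  assumes pd: "pos_definite A" and \<theta>: "0 \<le> \<theta>" "\<theta> \<le> 1"
  shows "quad_fun A b c ((1 - \<theta>) *\<^sub>R x + \<theta> *\<^sub>R y)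
    \<le> (1 - \<theta>) * quad_fun A b c x + \<theta> * quad_fun A b c y"
proof -
  have sym: "transpose A = A" using pd by (simp add: pos_definite_def)
  define d where "d = y - x"
  have "quad_fun A b c (x + \<theta> *\<^sub>R d) =
    (1 - \<theta>) * quad_fun A b c x + \<theta> * quad_fun A b c (x + d) - \<theta> * (1 - \<theta>) / 2 * (d \<bullet> (A *v d))"
    unfolding quad_fun_expand[OF sym, of b c x] by (simp add: matrix_vector_mult_scaleR field_simps)
  moreover have "0 \<le> \<theta> * (1 - \<theta>) / 2 * (d \<bullet> (A *v d))"
    using \<theta> pos_definite_nonneg[OF pd] by simp
  ultimately have "quad_fun A b c (x + \<theta> *\<^sub>R d) \<le>
    (1 - \<theta>) * quad_fun A b c x + \<theta> * quad_fun A b c (x + d)" by linarith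
  moreover have "(1 - \<theta>) *\<^sub>R x + \<theta> *\<^sub>R y = x + \<theta> *\<^sub>R d" "y = x + d"
    by (simp_all add: d_def algebra_simps)
  ultimately show ?thesis by simp
qed

section \<open>Minimization over a plane\<close>

text \<open>Replacing \<open>r\<close> by its component \<open>r'\<close> that is \<open>A\<close>-orthogonal to \<open>g\<close> decouples the two conditions,
  so each coefficient is an exact line search of its own.\<close>
lemma plane_stationary_point:
  fixes A :: "real^'n^'n"
  assumes pd: "pos_definite A" and g: "g \<noteq> 0"
  obtains \<alpha> \<beta> where "g \<bullet> quad_grad A b (x + \<alpha> *\<^sub>R g + \<beta> *\<^sub>R r) = 0"
    "r \<bullet> quad_grad A b (x + \<alpha> *\<^sub>R g + \<beta> *\<^sub>R r) = 0"
proof -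
  have sym: "transpose A = A" and pos: "\<And>x. x \<noteq> 0 \<Longrightarrow> 0 < x \<bullet> (A *v x)"
    using pd by (simp_all add: pos_definite_def)
  define p where "p = g \<bullet> (A *v g)"
  define q where "q = (g \<bullet> (A *v r)) / p"
  define r' where "r' = r - q *\<^sub>R g"
  define G where "G = quad_grad A b x"
  have p: "p > 0" using pos[OF g] by (simp add: p_def)
  have orth: "g \<bullet> (A *v r') = 0"
    using p by (simp add: r'_def inner_diff_right matrix_vector_mult_diff_distrib
      matrix_vector_mult_scaleR q_def p_def)
  then have orth': "r' \<bullet> (A *v g) = 0"
    using inner_matrix_commute[OF sym] by metis
  define s where "s = - (r' \<bullet> G) / (r' \<bullet> (A *v r'))"
  define a where "a = - (g \<bullet> G) / p"
  define z where "z = x + (a *\<^sub>R g + s *\<^sub>R r')"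
  have gz: "g \<bullet> quad_grad A b z = 0"
    using p orth by (simp add: z_def quad_grad_add inner_add_right inner_diff_right
      matrix_vector_right_distrib matrix_vector_mult_diff_distrib matrix_vector_mult_scaleR
      a_def p_def G_def)
  have "r' \<bullet> quad_grad A b z = 0"
    \<comment> \<open>If \<open>r' = 0\<close>, the directions are parallel and the second condition follows from the first.\<close>
    using pos[of r'] orth'
    by (cases "r' = 0") (simp_all add: z_def quad_grad_add inner_add_right inner_diff_right
      matrix_vector_right_distrib matrix_vector_mult_diff_distrib matrix_vector_mult_scaleR
      s_def G_def)
  then have rz: "r \<bullet> quad_grad A b z = 0"
    using gz by (simp add: r'_def inner_diff_left)
  have "z = x + (a - s * q) *\<^sub>R g + s *\<^sub>R r" by (simp add: z_def r'_def algebra_simps)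
  then show thesis using that gz rz by metis
qed

text \<open>Uniqueness concerns the minimizing point and not its coefficients: on the plane \<open>f\<close> exceeds its
  value at a stationary point \<open>z\<close> by half the squared energy distance to \<open>z\<close>.\<close>
lemma plane_minimizer_unique:
  fixes A :: "real^'n^'n"
  assumes pd: "pos_definite A" and g: "g \<noteq> 0"
  shows "\<exists>!z. \<exists>\<alpha> \<beta>. is_arg_min (\<lambda>(\<alpha>, \<beta>). quad_fun A b c (x + \<alpha> *\<^sub>R g + \<beta> *\<^sub>R r)) (\<lambda>_. True) (\<alpha>, \<beta>)
    \<and> z = x + \<alpha> *\<^sub>R g + \<beta> *\<^sub>R r"
proof -
  have sym: "transpose A = A" and pos: "\<And>x. x \<noteq> 0 \<Longrightarrow> 0 < x \<bullet> (A *v x)"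
    using pd by (simp_all add: pos_definite_def)
  obtain \<alpha>0 \<beta>0 where st: "g \<bullet> quad_grad A b (x + \<alpha>0 *\<^sub>R g + \<beta>0 *\<^sub>R r) = 0"
    "r \<bullet> quad_grad A b (x + \<alpha>0 *\<^sub>R g + \<beta>0 *\<^sub>R r) = 0"
    using plane_stationary_point[OF pd g] by blast
  define z where "z = x + \<alpha>0 *\<^sub>R g + \<beta>0 *\<^sub>R r"
  have plane: "quad_fun A b c (x + \<alpha> *\<^sub>R g + \<beta> *\<^sub>R r) = quad_fun A b c z
      + (1/2) * ((x + \<alpha> *\<^sub>R g + \<beta> *\<^sub>R r - z) \<bullet> (A *v (x + \<alpha> *\<^sub>R g + \<beta> *\<^sub>R r - z)))" for \<alpha> \<beta>
  proof -
    define d where "d = (\<alpha> - \<alpha>0) *\<^sub>R g + (\<beta> - \<beta>0) *\<^sub>R r"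
    have "d \<bullet> quad_grad A b z = 0"
      using st by (simp add: d_def inner_add_left z_def)
    moreover have "x + \<alpha> *\<^sub>R g + \<beta> *\<^sub>R r = z + d"
      by (simp add: d_def z_def algebra_simps)
    ultimately show ?thesis by (simp add: quad_fun_expand[OF sym])
  qed
  have minimal: "quad_fun A b c z \<le> quad_fun A b c (x + \<alpha> *\<^sub>R g + \<beta> *\<^sub>R r)" for \<alpha> \<beta>
    unfolding plane using pos_definite_nonneg[OF pd] by simp
  show ?thesis
  proof (intro ex1I[of _ z])
    show "\<exists>\<alpha> \<beta>. is_arg_min (\<lambda>(\<alpha>, \<beta>). quad_fun A b c (x + \<alpha> *\<^sub>R g + \<beta> *\<^sub>R r)) (\<lambda>_. True) (\<alpha>, \<beta>)
      \<and> z = x + \<alpha> *\<^sub>R g + \<beta> *\<^sub>R r"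
      using minimal unfolding z_def
      by (intro exI[of _ \<alpha>0] exI[of _ \<beta>0]) (auto simp: is_arg_min_linorder)
  next
    fix z'
    assume "\<exists>\<alpha> \<beta>. is_arg_min (\<lambda>(\<alpha>, \<beta>). quad_fun A b c (x + \<alpha> *\<^sub>R g + \<beta> *\<^sub>R r)) (\<lambda>_. True) (\<alpha>, \<beta>)
      \<and> z' = x + \<alpha> *\<^sub>R g + \<beta> *\<^sub>R r"
    then obtain \<alpha> \<beta> where z': "z' = x + \<alpha> *\<^sub>R g + \<beta> *\<^sub>R r"
      and "quad_fun A b c (x + \<alpha> *\<^sub>R g + \<beta> *\<^sub>R r) \<le> quad_fun A b c z"
      unfolding is_arg_min_linorder z_def by fastforce
    then have "(z' - z) \<bullet> (A *v (z' - z)) \<le> 0" by (simp add: plane z')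
    then show "z' = z" using pos[of "z' - z"] by force
  qed
qed

text \<open>As \<open>t \<noteq> 0\<close>, the vector \<open>A g\<close> is a combination of \<open>g\<close> and \<open>r\<close>, so two gradient steps of length
  \<open>s\<close> stay in the plane and the minimizer can only do better.\<close>
lemma plane_minimizer_decrease:
  fixes A :: "real^'n^'n"
  assumes pd: "pos_definite A" and l: "0 < l" "l \<le> L"
    and lower: "\<And>x. l * (x \<bullet> x) \<le> x \<bullet> (A *v x)" and upper: "\<And>x. x \<bullet> (A *v x) \<le> L * (x \<bullet> x)"
    and xstar: "quad_grad A b xstar = 0"
    and g: "g = quad_grad A b x" and r: "r = g - t *\<^sub>R (A *v g)" "t \<noteq> 0"
    and min: "is_arg_min (\<lambda>(\<alpha>, \<beta>). quad_fun A b c (x + \<alpha> *\<^sub>R g + \<beta> *\<^sub>R r)) (\<lambda>_. True) (\<alpha>, \<beta>)"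
  shows "quad_fun A b c (x + \<alpha> *\<^sub>R g + \<beta> *\<^sub>R r) - quad_fun A b c xstar
    \<le> ((L - l) / (L + l)) ^ 4 * (quad_fun A b c x - quad_fun A b c xstar)"
proof -
  have sym: "transpose A = A" using pd by (simp add: pos_definite_def)
  have best: "quad_fun A b c (x + \<alpha> *\<^sub>R g + \<beta> *\<^sub>R r) \<le> quad_fun A b c (x + \<alpha>' *\<^sub>R g + \<beta>' *\<^sub>R r)"
    for \<alpha>' \<beta>'
    using min by (auto simp: is_arg_min_linorder)
  define s where "s = 2 / (L + l)"
  define e where "e = x - xstar"
  define T where "T = (\<lambda>u. u - s *\<^sub>R (A *v u))"
  have ge: "g = A *v e"
    using xstar by (simp add: g e_def quad_grad_def matrix_vector_mult_diff_distrib)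
  have Ag: "A *v g = (1 / t) *\<^sub>R g - (1 / t) *\<^sub>R r"
  proof -
    have "t *\<^sub>R (A *v g) = t *\<^sub>R ((1 / t) *\<^sub>R g - (1 / t) *\<^sub>R r)"
      using r by (simp add: scaleR_right_diff_distrib)
    then show ?thesis using r(2) by (metis scaleR_cancel_left)
  qed
  \<comment> \<open>The competitor is \<open>xstar + (I - s A)\<^sup>2 e\<close>, written in the coordinates of the plane.\<close>
  have "T (T e) = e - s *\<^sub>R g - s *\<^sub>R (g - s *\<^sub>R (A *v g))"
    by (simp add: T_def ge matrix_vector_mult_diff_distrib matrix_vector_mult_scaleR)
  then have "xstar + T (T e) = x + (s\<^sup>2 / t - 2 * s) *\<^sub>R g + (- (s\<^sup>2 / t)) *\<^sub>R r"
    unfolding Ag by (simp add: e_def vec_eq_iff power2_eq_square algebra_simps)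
  then have "quad_fun A b c (x + \<alpha> *\<^sub>R g + \<beta> *\<^sub>R r) \<le> quad_fun A b c (xstar + T (T e))"
    using best by metis
  then have le: "quad_fun A b c (x + \<alpha> *\<^sub>R g + \<beta> *\<^sub>R r) - quad_fun A b c xstar
    \<le> (1/2) * (T (T e) \<bullet> (A *v T (T e)))"
    using quad_fun_gap[OF sym xstar, of c "xstar + T (T e)"] by simp
  define \<rho> where "\<rho> = (L - l) / (L + l)"
  have contract: "T u \<bullet> (A *v T u) \<le> \<rho>\<^sup>2 * (u \<bullet> (A *v u))" for u
    unfolding T_def s_def \<rho>_def by (rule richardson_step_contraction[OF sym l lower upper])
  have "T (T e) \<bullet> (A *v T (T e)) \<le> \<rho>\<^sup>2 * (\<rho>\<^sup>2 * (e \<bullet> (A *v e)))"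
    by (rule order_trans[OF contract mult_left_mono[OF contract]]) simp
  also have "\<dots> = \<rho> ^ 4 * (2 * (quad_fun A b c x - quad_fun A b c xstar))"
    using quad_fun_gap[OF sym xstar, of c x] by (simp add: e_def power4_eq_xxxx power2_eq_square)
  finally show ?thesis using le unfolding \<rho>_def by linarith
qed

section \<open>Steps of the method\<close>

lemma relaxME_step_active:
  assumes "\<not> h" "g \<noteq> 0"
    and t: "t = 2 * (norm g)\<^sup>2 / (g \<bullet> (A *v g))" and r: "r = g - t *\<^sub>R (A *v g)"
  shows "relaxME_step A b c \<theta> k x g h x' g' h' \<longleftrightarrow>
    (if g \<noteq> r \<and> independent {g, r} then
       \<not> h' \<and> (\<exists>\<alpha> \<beta>.
         is_arg_min (\<lambda>(\<alpha>, \<beta>). quad_fun A b c (x + \<alpha> *\<^sub>R g + \<beta> *\<^sub>R r)) (\<lambda>_. True) (\<alpha>, \<beta>) \<and>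
         (if k = 0 then x' = x + \<alpha> *\<^sub>R g + \<beta> *\<^sub>R r \<and> g' = quad_grad A b (x + \<alpha> *\<^sub>R g + \<beta> *\<^sub>R r)
          else x' = (1 - \<theta>) *\<^sub>R x + \<theta> *\<^sub>R (x + \<alpha> *\<^sub>R g + \<beta> *\<^sub>R r) \<and>
            g' = (1 - \<theta>) *\<^sub>R g + \<theta> *\<^sub>R quad_grad A b (x + \<alpha> *\<^sub>R g + \<beta> *\<^sub>R r)))
     else h' \<and> x' = x - (t / 2) *\<^sub>R g \<and> g' = quad_grad A b x')"
proof -
  have midpoint: "(1/2) *\<^sub>R (x + (x - t *\<^sub>R g)) = x - (t / 2) *\<^sub>R g"
    by (simp add: vec_eq_iff field_simps)
  show ?thesis
    unfolding relaxME_step_def Let_def t[symmetric] unfolding r[symmetric] midpoint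
    using assms(1,2) by simp
qed

lemma relaxME_step_unique:
  assumes pd: "pos_definite A"
  shows "\<exists>!s. relaxME_step A b c \<theta> k x g h (fst s) (fst (snd s)) (snd (snd s))"
proof (cases "h \<or> g = 0")
  case True
  then show ?thesis
    by (intro ex1I[of _ "(x, g, True)"]) (auto simp: relaxME_step_def prod_eq_iff)
next
  case False
  define t where "t = 2 * (norm g)\<^sup>2 / (g \<bullet> (A *v g))"
  define r where "r = g - t *\<^sub>R (A *v g)"
  define M where "M = (\<lambda>\<alpha> \<beta>. is_arg_min (\<lambda>(\<alpha>, \<beta>). quad_fun A b c (x + \<alpha> *\<^sub>R g + \<beta> *\<^sub>R r)) (\<lambda>_. True) (\<alpha>, \<beta>))"
  define R where "R = (\<lambda>u v z. if k = 0 then u = z \<and> v = quad_grad A b z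
    else u = (1 - \<theta>) *\<^sub>R x + \<theta> *\<^sub>R z \<and> v = (1 - \<theta>) *\<^sub>R g + \<theta> *\<^sub>R quad_grad A b z)"
  have "\<exists>!z. \<exists>\<alpha> \<beta>. M \<alpha> \<beta> \<and> z = x + \<alpha> *\<^sub>R g + \<beta> *\<^sub>R r"
    unfolding M_def using False by (intro plane_minimizer_unique pd) simp
  then obtain z where ex: "\<exists>\<alpha> \<beta>. M \<alpha> \<beta> \<and> z = x + \<alpha> *\<^sub>R g + \<beta> *\<^sub>R r"
    and uniq: "\<And>\<alpha> \<beta>. M \<alpha> \<beta> \<Longrightarrow> x + \<alpha> *\<^sub>R g + \<beta> *\<^sub>R r = z" by metis
  \<comment> \<open>The update depends on the coefficients only through the minimizing point.\<close>
  have iff: "(\<exists>\<alpha> \<beta>. M \<alpha> \<beta> \<and> R u v (x + \<alpha> *\<^sub>R g + \<beta> *\<^sub>R r)) \<longleftrightarrow> R u v z" for u v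
    using ex uniq by metis
  have step: "relaxME_step A b c \<theta> k x g h u v w \<longleftrightarrow>
      (if g \<noteq> r \<and> independent {g, r} then \<not> w \<and> R u v z
       else w \<and> u = x - (t / 2) *\<^sub>R g \<and> v = quad_grad A b u)" for u v w
    unfolding iff[symmetric] unfolding M_def R_def
    using False by (intro relaxME_step_active[OF _ _ t_def r_def]) simp_all
  define x' where "x' = (if g \<noteq> r \<and> independent {g, r} then
     if k = 0 then z else (1 - \<theta>) *\<^sub>R x + \<theta> *\<^sub>R z else x - (t / 2) *\<^sub>R g)"
  define g' where "g' = (if g \<noteq> r \<and> independent {g, r} \<and> k \<noteq> 0 then
     (1 - \<theta>) *\<^sub>R g + \<theta> *\<^sub>R quad_grad A b z else quad_grad A b x')"
  have "relaxME_step A b c \<theta> k x g h u v w \<longleftrightarrow>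
      u = x' \<and> v = g' \<and> w = (\<not> (g \<noteq> r \<and> independent {g, r}))" for u v w
    unfolding step R_def by (auto simp: x'_def g'_def)
  then show ?thesis
    by (intro ex1I[of _ "(x', g', \<not> (g \<noteq> r \<and> independent {g, r}))"]) (simp_all add: prod_eq_iff)
qed

lemma relaxME_sequence_unique:
  assumes pd: "pos_definite A"
  shows "\<exists>!x. relaxME_sequence A b c \<theta> x0 x"
proof -
  define S where "S = (\<lambda>k s s'. relaxME_step A b c \<theta> k (fst s) (fst (snd s)) (snd (snd s))
    (fst s') (fst (snd s')) (snd (snd s')))"
  have step: "\<exists>!s'. S k s s'" for k s
    unfolding S_def by (rule relaxME_step_unique[OF pd])
  define s0 where "s0 = (x0, quad_grad A b x0, False)"
  define f where "f = rec_nat s0 (\<lambda>k s. THE s'. S k s s')"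
  have f: "f 0 = s0" "S k (f k) (f (Suc k))" for k
    using theI'[OF step] by (simp_all add: f_def)
  have "relaxME_sequence A b c \<theta> x0 (\<lambda>k. fst (f k))"
    unfolding relaxME_sequence_def
    by (intro exI[of _ "\<lambda>k. fst (snd (f k))"] exI[of _ "\<lambda>k. snd (snd (f k))"])
      (use f in \<open>simp add: S_def s0_def\<close>)
  moreover have "x = (\<lambda>k. fst (f k))" if "relaxME_sequence A b c \<theta> x0 x" for x
  proof -
    obtain g h where 0: "x 0 = x0" "g 0 = quad_grad A b x0" "\<not> h 0"
      and Suc: "\<And>k. relaxME_step A b c \<theta> k (x k) (g k) (h k) (x (Suc k)) (g (Suc k)) (h (Suc k))"
      using \<open>relaxME_sequence A b c \<theta> x0 x\<close> unfolding relaxME_sequence_def by metis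
    have "(x k, g k, h k) = f k" for k
    proof (induction k)
      case 0
      then show ?case using f 0 by (simp add: s0_def \<open>x 0 = x0\<close> \<open>g 0 = _\<close> \<open>\<not> h 0\<close>)
    next
      case (Suc k)
      have "S k (f k) (x (Suc k), g (Suc k), h (Suc k))"
        using \<open>relaxME_step A b c \<theta> k (x k) (g k) (h k) (x (Suc k)) (g (Suc k)) (h (Suc k))\<close>
        unfolding Suc.IH[symmetric] S_def by simp
      then show ?case using f(2) step by blast
    qed
    then show ?thesis by (metis fst_conv)
  qed
  ultimately show ?thesis by blast
qed

text \<open>The first two conclusions reproduce the hypotheses on \<open>g\<close> and \<open>h\<close> for the next iteration: \<open>g\<close> is
  the gradient, and it vanishes once the method has stopped. The third is the decrease in one
  iteration; the unrelaxed first iteration satisfies it because \<open>((L - l) / (L + l)) ^ 4 \<le> \<eta>\<close>.\<close>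
lemma relaxME_step_decrease:
  fixes A :: "real^'n^'n"
  assumes pd: "pos_definite A" and l: "0 < l" "l \<le> L"
    and lower: "\<And>x. l * (x \<bullet> x) \<le> x \<bullet> (A *v x)" and upper: "\<And>x. x \<bullet> (A *v x) \<le> L * (x \<bullet> x)"
    and xstar: "quad_grad A b xstar = 0" and \<theta>: "0 \<le> \<theta>" "\<theta> \<le> 1"
    and g: "g = quad_grad A b x" and h: "h \<Longrightarrow> g = 0"
    and step: "relaxME_step A b c \<theta> k x g h x' g' h'"
  defines "\<eta> \<equiv> (1 - \<theta>) + \<theta> * ((L - l) / (L + l)) ^ 4"
  shows "g' = quad_grad A b x'" "h' \<Longrightarrow> g' = 0"
    "quad_fun A b c x' - quad_fun A b c xstar \<le> \<eta> * (quad_fun A b c x - quad_fun A b c xstar)"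
proof -
  have sym: "transpose A = A" using pd by (simp add: pos_definite_def)
  define F where "F = (\<lambda>x. quad_fun A b c x - quad_fun A b c xstar)"
  have F0: "0 \<le> F x" for x
    using quad_fun_gap[OF sym xstar, of c x] pos_definite_nonneg[OF pd, of "x - xstar"]
    by (simp add: F_def)
  have \<rho>1: "((L - l) / (L + l)) ^ 4 \<le> 1"
    using l by (intro power_le_one) simp_all
  have \<rho>0: "0 \<le> ((L - l) / (L + l)) ^ 4" by simp
  have \<eta>0: "0 \<le> \<eta>" using \<theta> \<rho>0 unfolding \<eta>_def by simp
  have solved: "F u \<le> \<eta> * F x" if "quad_grad A b u = 0" for u
    using that quad_grad_zero_iff[OF pd xstar] F0[of x] \<eta>0 by (simp add: F_def)
  have "g' = quad_grad A b x' \<and> (h' \<longrightarrow> g' = 0) \<and> F x' \<le> \<eta> * F x"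
  proof (cases "g = 0")
    case True
    then have "x' = x" "g' = g" using step by (simp_all add: relaxME_step_def)
    then show ?thesis using True g solved by simp
  next
    case False
    then have nh: "\<not> h" using h by blast
    have p: "0 < g \<bullet> (A *v g)" using pd False by (simp add: pos_definite_def)
    define t where "t = 2 * (norm g)\<^sup>2 / (g \<bullet> (A *v g))"
    define r where "r = g - t *\<^sub>R (A *v g)"
    note active = relaxME_step_active[OF nh False t_def r_def]
    have t0: "t \<noteq> 0" using p False by (simp add: t_def)
    show ?thesis
    proof (cases "g \<noteq> r \<and> independent {g, r}")
      case True
      define z where "z = (\<lambda>\<alpha> \<beta>. x + \<alpha> *\<^sub>R g + \<beta> *\<^sub>R r)"
      obtain \<alpha> \<beta> where
        min: "is_arg_min (\<lambda>(\<alpha>, \<beta>). quad_fun A b c (x + \<alpha> *\<^sub>R g + \<beta> *\<^sub>R r)) (\<lambda>_. True) (\<alpha>, \<beta>)"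
        and next_state: "\<not> h'" "if k = 0 then x' = z \<alpha> \<beta> \<and> g' = quad_grad A b (z \<alpha> \<beta>)
          else x' = (1 - \<theta>) *\<^sub>R x + \<theta> *\<^sub>R z \<alpha> \<beta> \<and> g' = (1 - \<theta>) *\<^sub>R g + \<theta> *\<^sub>R quad_grad A b (z \<alpha> \<beta>)"
        using iffD1[OF active step] unfolding if_P[OF True] z_def by blast
      have dec: "F (z \<alpha> \<beta>) \<le> ((L - l) / (L + l)) ^ 4 * F x"
        unfolding F_def z_def
        by (rule plane_minimizer_decrease[OF pd l lower upper xstar g r_def t0 min])
      show ?thesis
      proof (cases "k = 0")
        case True
        have "\<theta> * (1 - ((L - l) / (L + l)) ^ 4) \<le> 1 * (1 - ((L - l) / (L + l)) ^ 4)"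
          using \<theta> \<rho>1 by (intro mult_right_mono) auto
        then have "((L - l) / (L + l)) ^ 4 \<le> \<eta>"
          unfolding \<eta>_def by (simp add: algebra_simps)
        then have "F (z \<alpha> \<beta>) \<le> \<eta> * F x"
          using dec F0[of x] by (meson mult_right_mono order_trans)
        then show ?thesis using next_state True by simp
      next
        case k: False
        have "quad_fun A b c x' \<le> (1 - \<theta>) * quad_fun A b c x + \<theta> * quad_fun A b c (z \<alpha> \<beta>)"
          using quad_fun_convex[OF pd \<theta>, of b c x "z \<alpha> \<beta>"] next_state k by simp
        then have "F x' \<le> (1 - \<theta>) * F x + \<theta> * F (z \<alpha> \<beta>)"
          by (simp add: F_def algebra_simps)
        also have "\<dots> \<le> (1 - \<theta>) * F x + \<theta> * (((L - l) / (L + l)) ^ 4 * F x)"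
          using dec \<theta> by (simp add: mult_left_mono)
        finally have "F x' \<le> \<eta> * F x" by (simp add: \<eta>_def algebra_simps)
        then show ?thesis using next_state k g by (simp add: quad_grad_affine)
      qed
    next
      case dep: False
      have x': "x' = x + (- t / 2) *\<^sub>R g" and g': "g' = quad_grad A b x'"
        using iffD1[OF active step] unfolding if_not_P[OF dep] by simp_all
      have "\<exists>a. r = a *\<^sub>R g"
      proof (cases "g = r")
        case True
        then show ?thesis by (metis scaleR_one)
      next
        case ne: False
        then have "dependent {g, r}" using dep by simp
        have "r \<in> span {g}"
        proof (rule ccontr)
          assume "r \<notin> span {g}"
          then have "independent (insert r {g})"
            using False by (intro independent_insertI) (simp_all add: independent_empty)
          then show False using \<open>dependent {g, r}\<close> by (simp add: insert_commute)
        qed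
        then show ?thesis by (auto simp: span_singleton)
      qed
      then obtain a where a: "r = a *\<^sub>R g" by blast
      define \<mu> where "\<mu> = (1 - a) / t"
      have "t *\<^sub>R (A *v g) = (1 - a) *\<^sub>R g"
        using a unfolding r_def by (simp add: algebra_simps)
      then have "t *\<^sub>R (A *v g) = t *\<^sub>R (\<mu> *\<^sub>R g)"
        using t0 by (simp add: \<mu>_def)
      then have eig: "A *v g = \<mu> *\<^sub>R g" using t0 unfolding scaleR_cancel_left by blast
      \<comment> \<open>Half of \<open>t\<close> is the inverse eigenvalue, so \<open>x'\<close> is where the gradient vanishes.\<close>
      then have "\<mu> \<noteq> 0" using p by auto
      then have "t * \<mu> = 2"
        using eig False by (simp add: t_def dot_square_norm)
      then have "quad_grad A b x' = 0"
        unfolding x' quad_grad_add g[symmetric] matrix_vector_mult_scaleR eig by simp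
      then show ?thesis using g' solved by simp
    qed
  qed
  then show "g' = quad_grad A b x'" "h' \<Longrightarrow> g' = 0"
    "quad_fun A b c x' - quad_fun A b c xstar \<le> \<eta> * (quad_fun A b c x - quad_fun A b c xstar)"
    unfolding F_def by blast+
qed

lemma relaxME_sequence_decrease:
  fixes A :: "real^'n^'n"
  assumes pd: "pos_definite A" and l: "0 < l" "l \<le> L"
    and lower: "\<And>x. l * (x \<bullet> x) \<le> x \<bullet> (A *v x)" and upper: "\<And>x. x \<bullet> (A *v x) \<le> L * (x \<bullet> x)"
    and xstar: "quad_grad A b xstar = 0" and \<theta>: "0 \<le> \<theta>" "\<theta> \<le> 1"
    and seq: "relaxME_sequence A b c \<theta> x0 x"
  defines "\<eta> \<equiv> (1 - \<theta>) + \<theta> * ((L - l) / (L + l)) ^ 4"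
  shows "quad_fun A b c (x k) - quad_fun A b c xstar
    \<le> \<eta> ^ k * (quad_fun A b c x0 - quad_fun A b c xstar)"
proof -
  obtain g h where init: "x 0 = x0" "g 0 = quad_grad A b x0" "\<not> h 0"
    and step: "\<And>k. relaxME_step A b c \<theta> k (x k) (g k) (h k) (x (Suc k)) (g (Suc k)) (h (Suc k))"
    using seq unfolding relaxME_sequence_def by metis
  have \<eta>0: "0 \<le> \<eta>" using \<theta> unfolding \<eta>_def by simp
  note next_step = relaxME_step_decrease[OF pd l lower upper xstar \<theta> _ _ step, folded \<eta>_def]
  have "g k = quad_grad A b (x k) \<and> (h k \<longrightarrow> g k = 0) \<and>
    quad_fun A b c (x k) - quad_fun A b c xstar
      \<le> \<eta> ^ k * (quad_fun A b c x0 - quad_fun A b c xstar)"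
  proof (induction k)
    case 0
    then show ?case using init by simp
  next
    case (Suc k)
    have state: "g k = quad_grad A b (x k)" "h k \<Longrightarrow> g k = 0" using Suc by auto
    have "quad_fun A b c (x (Suc k)) - quad_fun A b c xstar
      \<le> \<eta> * (quad_fun A b c (x k) - quad_fun A b c xstar)"
      by (rule next_step(3)[OF state])
    also have "\<dots> \<le> \<eta> * (\<eta> ^ k * (quad_fun A b c x0 - quad_fun A b c xstar))"
      using Suc \<eta>0 by (simp add: mult_left_mono)
    finally show ?case
      using next_step(1,2)[OF state] by (simp add: mult.assoc)
  qed
  then show ?thesis by blast
qed

section \<open>Convergence\<close>

theorem theorem2p5:
  fixes A :: "real^'n^'n" and b x0 :: "real^'n" and c \<theta> \<kappa> \<eta>bar :: real
    and lam :: "nat \<Rightarrow> real"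
  assumes "pos_definite A"
    and "eigenvalue_listing A lam"
    and "0 < \<theta>" "\<theta> \<le> 1"
  defines "\<kappa> \<equiv> lam (CARD('n)) / lam 1"
  defines "\<eta>bar \<equiv> (1 - \<theta>) + \<theta> * ((\<kappa> - 1) / (\<kappa> + 1)) ^ 4"
  shows "\<exists>xstar x.
    (\<forall>z. is_arg_min (quad_fun A b c) (\<lambda>_. True) z \<longleftrightarrow> z = xstar) \<and>
    (\<forall>x'. relaxME_sequence A b c \<theta> x0 x' \<longleftrightarrow> x' = x) \<and>
    x \<longlonglongrightarrow> xstar \<and>
    0 \<le> \<eta>bar \<and> \<eta>bar < 1 \<and>
    (\<exists>\<eta>. 0 \<le> \<eta> \<and> \<eta> \<le> \<eta>bar \<and>
      (\<forall>k. quad_fun A b c (x k) - quad_fun A b c xstar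
             \<le> \<eta> ^ k * (quad_fun A b c x0 - quad_fun A b c xstar) \<and>
           mat_norm A (x k - xstar) \<le> sqrt (\<eta> ^ k) * mat_norm A (x0 - xstar)))"
proof -
  define l L where "l = lam 1" and "L = lam (CARD('n))"
  note pd = assms(1) and \<theta> = assms(3,4)
  have sym: "transpose A = A" using pd by (simp add: pos_definite_def)
  have l: "0 < l" "l \<le> L"
    and lower: "\<And>x. l * (x \<bullet> x) \<le> x \<bullet> (A *v x)" and upper: "\<And>x. x \<bullet> (A *v x) \<le> L * (x \<bullet> x)"
    unfolding l_def L_def by (rule extreme_eigenvalue_bounds[OF assms(1,2)])+
  have ratio: "(\<kappa> - 1) / (\<kappa> + 1) = (L - l) / (L + l)"
  proof -
    have "\<kappa> - 1 = (L - l) / l" "\<kappa> + 1 = (L + l) / l"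
      using l(1) by (simp_all add: \<kappa>_def l_def L_def diff_divide_distrib add_divide_distrib)
    then show ?thesis using l(1) by simp
  qed
  have "(L - l) / (L + l) < 1" "0 \<le> (L - l) / (L + l)" using l by simp_all
  then have "((\<kappa> - 1) / (\<kappa> + 1)) ^ 4 < 1"
    unfolding ratio by (subst power_less_one_iff) simp_all
  then have "\<theta> * ((\<kappa> - 1) / (\<kappa> + 1)) ^ 4 < \<theta>" using \<theta> by simp
  then have \<eta>1: "\<eta>bar < 1" by (simp add: \<eta>bar_def)
  have \<eta>0: "0 \<le> \<eta>bar" using \<theta> by (simp add: \<eta>bar_def)
  obtain xstar where xstar: "quad_grad A b xstar = 0" using quad_grad_zero_exists[OF pd] by blast
  obtain x where x: "relaxME_sequence A b c \<theta> x0 x"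
    and unique: "\<forall>x'. relaxME_sequence A b c \<theta> x0 x' \<longleftrightarrow> x' = x"
    using relaxME_sequence_unique[OF pd, of b c \<theta> x0] by metis
  have gap: "quad_fun A b c z - quad_fun A b c xstar = (mat_norm A (z - xstar))\<^sup>2 / 2" for z
    using quad_fun_gap[OF sym xstar] pos_definite_nonneg[OF pd] by (simp add: mat_norm_def)
  have norm_lower: "l * (norm z)\<^sup>2 \<le> (mat_norm A z)\<^sup>2" for z
    using lower[of z] pos_definite_nonneg[OF pd, of z] by (simp add: mat_norm_def power2_norm_eq_inner)
  have argmin: "is_arg_min (quad_fun A b c) (\<lambda>_. True) z \<longleftrightarrow> z = xstar" for z
  proof
    assume "is_arg_min (quad_fun A b c) (\<lambda>_. True) z"
    then have "quad_fun A b c z \<le> quad_fun A b c xstar" by (simp add: is_arg_min_linorder)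
    then have "l * (norm (z - xstar))\<^sup>2 \<le> 0"
      using gap[of z] norm_lower[of "z - xstar"] by linarith
    then show "z = xstar" using l(1) by (simp add: mult_le_0_iff)
  next
    assume "z = xstar"
    moreover have "quad_fun A b c xstar \<le> quad_fun A b c y" for y
      using gap[of y] zero_le_power2[of "mat_norm A (y - xstar)"] by linarith
    ultimately show "is_arg_min (quad_fun A b c) (\<lambda>_. True) z" by (simp add: is_arg_min_linorder)
  qed
  have decrease: "quad_fun A b c (x k) - quad_fun A b c xstar
    \<le> \<eta>bar ^ k * (quad_fun A b c x0 - quad_fun A b c xstar)" for k
    using relaxME_sequence_decrease[OF pd l lower upper xstar _ \<theta>(2) x] \<theta>(1)
    unfolding \<eta>bar_def ratio by simp
  have norm_sq: "(mat_norm A (x k - xstar))\<^sup>2 \<le> \<eta>bar ^ k * (mat_norm A (x0 - xstar))\<^sup>2" for k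
    using decrease[of k] by (simp add: gap)
  have norm_decrease: "mat_norm A (x k - xstar) \<le> sqrt (\<eta>bar ^ k) * mat_norm A (x0 - xstar)" for k
  proof (rule power2_le_imp_le)
    show "(mat_norm A (x k - xstar))\<^sup>2 \<le> (sqrt (\<eta>bar ^ k) * mat_norm A (x0 - xstar))\<^sup>2"
      using norm_sq[of k] \<eta>0 by (simp add: power_mult_distrib)
    show "0 \<le> sqrt (\<eta>bar ^ k) * mat_norm A (x0 - xstar)"
      using \<eta>0 pos_definite_nonneg[OF pd] by (simp add: mat_norm_def)
  qed
  have "(\<lambda>k. (norm (x k - xstar))\<^sup>2) \<longlonglongrightarrow> 0"
  proof (rule tendsto_sandwich[where f = "\<lambda>_. 0"])
    show "\<forall>\<^sub>F k in sequentially. (norm (x k - xstar))\<^sup>2 \<le> \<eta>bar ^ k * ((mat_norm A (x0 - xstar))\<^sup>2 / l)"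
    proof (intro always_eventually allI)
      fix k
      have "l * (norm (x k - xstar))\<^sup>2 \<le> \<eta>bar ^ k * (mat_norm A (x0 - xstar))\<^sup>2"
        by (rule order_trans[OF norm_lower norm_sq])
      then show "(norm (x k - xstar))\<^sup>2 \<le> \<eta>bar ^ k * ((mat_norm A (x0 - xstar))\<^sup>2 / l)"
        using l(1) by (simp add: pos_le_divide_eq mult.commute[of l])
    qed
    have "(\<lambda>k. \<eta>bar ^ k) \<longlonglongrightarrow> 0" using \<eta>0 \<eta>1 by (intro LIMSEQ_power_zero) simp
    then show "(\<lambda>k. \<eta>bar ^ k * ((mat_norm A (x0 - xstar))\<^sup>2 / l)) \<longlonglongrightarrow> 0"
      by (rule tendsto_mult_left_zero)
  qed simp_all
  then have "(\<lambda>k. sqrt ((norm (x k - xstar))\<^sup>2)) \<longlonglongrightarrow> sqrt 0"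
    by (rule tendsto_real_sqrt)
  then have "(\<lambda>k. norm (x k - xstar)) \<longlonglongrightarrow> 0" by simp
  then have lim: "x \<longlonglongrightarrow> xstar" by (rule LIM_zero_cancel[OF tendsto_norm_zero_cancel])
  have rate: "\<exists>\<eta>. 0 \<le> \<eta> \<and> \<eta> \<le> \<eta>bar \<and>
    (\<forall>k. quad_fun A b c (x k) - quad_fun A b c xstar
           \<le> \<eta> ^ k * (quad_fun A b c x0 - quad_fun A b c xstar) \<and>
         mat_norm A (x k - xstar) \<le> sqrt (\<eta> ^ k) * mat_norm A (x0 - xstar))"
    by (rule exI[of _ \<eta>bar]) (intro conjI allI \<eta>0 order_refl decrease norm_decrease)
  show ?thesis
    by (rule exI[of _ xstar], rule exI[of _ x])
      (intro conjI allI[OF argmin] unique lim \<eta>0 \<eta>1 rate)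
qed

end
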